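(* Every finite tournament is a subtournament of a finite Type-I regular tournament. That is, for every finite tournament $T$ there exist a finite regular tournament $R$ of Type-I and an injective map $f$ from the vertex set of $T$ to the vertex set of $R$ such that for all vertices $x,y$ of $T$, $x\to y$ in $T$ if and only if $f(x)\to f(y)$ in $R$.
   Context: A tournament is a pair $T=(V,E)$, where $V$ is a finite nonempty set of vertices and $E\subseteq V\times V$ is a relation such that $(v,v)\notin E$ for all $v$, and for any two distinct $u,v\in V$ exactly one of $(u,v)\in E$, $(v,u)\in E$ holds. We write $u\to v$ when $(u,v)\in E$. For a vertex $v$, let $\mathrm{IN}(v)=\{u\in V: u\to v\}$ and $\mathrm{OUT}(v)=\{u\in V: v\to u\}$; each of these sets (possibly empty) is regarded as carrying the edge relation induced from $T$. A tournament is regular if $|\mathrm{IN}(v)|=|\mathrm{OUT}(v)|$ for every vertex $v$. A regular tournament is of Type-I if there exists a vertex $v$ such that the induced subtournament on $\mathrm{IN}(v)$ is isomorphic to the induced subtournament on $\mathrm{OUT}(v)$, i.e. there is a bijection $\mathrm{IN}(v)\to\mathrm{OUT}(v)$ preserving and reflecting $\to$. *)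

theory Defs
  imports "Graph_Theory.Pair_Digraph" "Graph_Theory.Digraph_Isomorphism"
begin

text \<open>
  The locale \<^locale>\<open>pair_digraph\<close> provides finiteness of the vertex set, the inclusion of the
  arcs in the square of the vertex set, and the absence of loops.
\<close>

locale tournament = pair_digraph T for T :: "'a pair_pre_digraph" +
  assumes verts_nonempty: "pverts T \<noteq> {}"
    and exactly_one: "\<And>u v. \<lbrakk>u \<in> pverts T; v \<in> pverts T; u \<noteq> v\<rbrakk>
      \<Longrightarrow> (u, v) \<in> parcs T \<longleftrightarrow> (v, u) \<notin> parcs T"

definition IN :: "'a pair_pre_digraph \<Rightarrow> 'a \<Rightarrow> 'a set" where
  "IN T v = {u \<in> pverts T. (u, v) \<in> parcs T}"

definition OUT :: "'a pair_pre_digraph \<Rightarrow> 'a \<Rightarrow> 'a set" where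
  "OUT T v = {u \<in> pverts T. (v, u) \<in> parcs T}"

definition regular_tournament :: "'a pair_pre_digraph \<Rightarrow> bool" where
  "regular_tournament T \<longleftrightarrow>
     tournament T \<and> (\<forall>v \<in> pverts T. card (IN T v) = card (OUT T v))"

definition type_I_tournament :: "'a pair_pre_digraph \<Rightarrow> bool" where
  "type_I_tournament T \<longleftrightarrow>
     regular_tournament T \<and>
     (\<exists>v \<in> pverts T. digraph_iso (with_proj T \<restriction> IN T v) (with_proj T \<restriction> OUT T v))"

text \<open>
  For induced subgraphs of digraphs without parallel arcs, the library's \<^const>\<open>digraph_iso\<close>
  (which also carries a map on arcs) amounts to a bijection of the vertices that preserves and
  reflects the arcs.
\<close>

lemma digraph_iso_induced_iff:
  "digraph_iso (with_proj T \<restriction> A) (with_proj T \<restriction> B) \<longleftrightarrow>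
     (\<exists>g. bij_betw g A B \<and>
       (\<forall>x \<in> A. \<forall>y \<in> A. (x, y) \<in> parcs T \<longleftrightarrow> (g x, g y) \<in> parcs T))"
  (is "?L \<longleftrightarrow> ?R")
proof
  assume ?L
  then obtain h where h: "pre_digraph.digraph_isomorphism (with_proj T \<restriction> A) h"
    and eq: "with_proj T \<restriction> B = app_iso h (with_proj T \<restriction> A)"
    by (auto simp: digraph_iso_def)
  have vs: "iso_verts h ` A = B"
    using arg_cong[OF eq, of verts] by (simp add: induce_subgraph_def)
  have ars: "{e \<in> parcs T. fst e \<in> B \<and> snd e \<in> B}
      = iso_arcs h ` {e \<in> parcs T. fst e \<in> A \<and> snd e \<in> A}"
    using arg_cong[OF eq, of arcs] by (simp add: induce_subgraph_def)
  have tl: "iso_tail h = fst" "iso_head h = snd"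
    using arg_cong[OF eq, of tail] arg_cong[OF eq, of head]
    by (simp_all add: induce_subgraph_def)
  have inj: "inj_on (iso_verts h) A"
    using h by (simp add: pre_digraph.digraph_isomorphism_def induce_subgraph_def)
  have arcmap: "iso_arcs h e = (iso_verts h (fst e), iso_verts h (snd e))"
    if "e \<in> parcs T" "fst e \<in> A" "snd e \<in> A" for e
    using h that tl
    by (cases e) (auto simp: pre_digraph.digraph_isomorphism_def induce_subgraph_def prod_eq_iff)
  have "(x, y) \<in> parcs T \<longleftrightarrow> (iso_verts h x, iso_verts h y) \<in> parcs T"
    if xy: "x \<in> A" "y \<in> A" for x y
  proof
    assume a: "(x, y) \<in> parcs T"
    then have "iso_arcs h (x, y) \<in> {e \<in> parcs T. fst e \<in> B \<and> snd e \<in> B}"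
      using ars xy by force
    then show "(iso_verts h x, iso_verts h y) \<in> parcs T"
      using arcmap[OF a] xy by simp
  next
    assume "(iso_verts h x, iso_verts h y) \<in> parcs T"
    then have "(iso_verts h x, iso_verts h y) \<in> {e \<in> parcs T. fst e \<in> B \<and> snd e \<in> B}"
      using vs xy by auto
    then obtain e where e: "e \<in> parcs T" "fst e \<in> A" "snd e \<in> A"
      "(iso_verts h x, iso_verts h y) = iso_arcs h e"
      unfolding ars by blast
    then have "x = fst e" "y = snd e"
      using arcmap[of e] inj xy by (auto dest: inj_onD)
    then show "(x, y) \<in> parcs T" using e by simp
  qed
  then show ?R using inj vs by (auto simp: bij_betw_def)
next
  assume ?R
  then obtain g where inj: "inj_on g A" and im: "g ` A = B"
    and pr: "\<And>x y. \<lbrakk>x \<in> A; y \<in> A\<rbrakk> \<Longrightarrow> (x, y) \<in> parcs T \<longleftrightarrow> (g x, g y) \<in> parcs T"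
    by (auto simp: bij_betw_def)
  define h where "h = \<lparr> iso_verts = g, iso_arcs = map_prod g g, iso_head = snd, iso_tail = fst \<rparr>"
  have "pre_digraph.digraph_isomorphism (with_proj T \<restriction> A) h"
    using inj unfolding pre_digraph.digraph_isomorphism_def h_def
    by (auto simp: induce_subgraph_def wf_digraph_def inj_on_def)
  moreover have "map_prod g g ` {e \<in> parcs T. fst e \<in> A \<and> snd e \<in> A}
      = {e \<in> parcs T. fst e \<in> B \<and> snd e \<in> B}"
    unfolding im[symmetric] using pr by (force simp: image_iff)
  then have "with_proj T \<restriction> B = app_iso h (with_proj T \<restriction> A)"
    using im by (simp add: app_iso_def induce_subgraph_def h_def)
  ultimately show ?L by (auto simp: digraph_iso_def)
qed

end

theory Submission
  imports Defs
begin

text \<open>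
  Take two copies of \<open>T\<close>, with vertices \<open>a x\<close> and \<open>b x\<close>, and a new vertex \<open>c\<close> that dominates the
  first copy and is dominated by the second. Orient the arcs between the copies against \<open>T\<close>:
  \<open>a x \<rightarrow> b y\<close> if \<open>y \<rightarrow> x\<close> or \<open>x = y\<close>, and \<open>b x \<rightarrow> a y\<close> if \<open>y \<rightarrow> x\<close>. The out-neighbours (and likewise
  the in-neighbours) of any vertex other than \<open>c\<close> then correspond to \<open>OUT x\<close>, \<open>IN x\<close> and one further
  vertex, so that every degree equals the number of vertices of \<open>T\<close>.
\<close>

locale tournament_doubling = tournament T for T :: "'a pair_pre_digraph" +
  fixes a b :: "'a \<Rightarrow> 'b" and c :: 'b
  assumes inj_a: "inj_on a (pverts T)" and inj_b: "inj_on b (pverts T)"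
    and a_neq_b: "\<And>x y. \<lbrakk>x \<in> pverts T; y \<in> pverts T\<rbrakk> \<Longrightarrow> a x \<noteq> b y"
    and a_neq_c: "\<And>x. x \<in> pverts T \<Longrightarrow> a x \<noteq> c"
    and b_neq_c: "\<And>x. x \<in> pverts T \<Longrightarrow> b x \<noteq> c"
begin

text \<open>Arcs of \<open>T\<close> already join vertices of \<open>T\<close>, so in the
  comprehensions only the diagonal arcs from \<open>a x\<close> to \<open>b x\<close> need the guard
  \<open>x \<in> pverts T\<close>; it binds to \<open>x = y\<close> alone.\<close>

definition doubling :: "'b pair_pre_digraph" where
  "doubling = \<lparr> pverts = insert c (a ` pverts T \<union> b ` pverts T),
     parcs = {c} \<times> a ` pverts T \<union> b ` pverts T \<times> {c}
       \<union> {(a x, a y) |x y. (x, y) \<in> parcs T} \<union> {(b x, b y) |x y. (x, y) \<in> parcs T}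
       \<union> {(a x, b y) |x y. x \<in> pverts T \<and> x = y \<or> (y, x) \<in> parcs T}
       \<union> {(b x, a y) |x y. (y, x) \<in> parcs T} \<rparr>"

lemma pverts_doubling: "pverts doubling = insert c (a ` pverts T \<union> b ` pverts T)"
  by (simp add: doubling_def)

lemma arc_in_verts: "(x, y) \<in> parcs T \<Longrightarrow> x \<in> pverts T \<and> y \<in> pverts T"
  using in_arcsD1 in_arcsD2 by blast

text \<open>Absence of loops settles the diagonal, which \<open>exactly_one\<close> leaves out. It
  is needed when \<open>a x\<close> is compared with \<open>b y\<close>: these differ even if
  \<open>x = y\<close>.\<close>

lemma arc_iff:
  assumes "x \<in> pverts T" "y \<in> pverts T"
  shows "(x, y) \<in> parcs T \<longleftrightarrow> x \<noteq> y \<and> (y, x) \<notin> parcs T"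
  using exactly_one[OF assms] no_loops[of "(x, y)"] by (cases "x = y") auto

lemma inj_simps:
  assumes "x \<in> pverts T" "y \<in> pverts T"
  shows "a x = a y \<longleftrightarrow> x = y" "b x = b y \<longleftrightarrow> x = y"
  using assms inj_a inj_b by (auto dest: inj_onD)

lemmas neq_simps = a_neq_b a_neq_b[symmetric] a_neq_c a_neq_c[symmetric] b_neq_c b_neq_c[symmetric]

lemma centre_no_loop: "(c, c) \<notin> parcs doubling"
  by (auto simp: doubling_def neq_simps dest: arc_in_verts)

lemma parcs_doubling_centre:
  assumes "x \<in> pverts T"
  shows "(c, a x) \<in> parcs doubling" "(a x, c) \<notin> parcs doubling"
    "(b x, c) \<in> parcs doubling" "(c, b x) \<notin> parcs doubling"
  using assms by (auto simp: doubling_def neq_simps dest: arc_in_verts)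

lemma parcs_doubling_copies:
  assumes "x \<in> pverts T" "y \<in> pverts T"
  shows "(a x, a y) \<in> parcs doubling \<longleftrightarrow> (x, y) \<in> parcs T"
    "(b x, b y) \<in> parcs doubling \<longleftrightarrow> (x, y) \<in> parcs T"
    "(a x, b y) \<in> parcs doubling \<longleftrightarrow> x = y \<or> (y, x) \<in> parcs T"
    "(b x, a y) \<in> parcs doubling \<longleftrightarrow> (y, x) \<in> parcs T"
  using assms
  by (auto simp: doubling_def neq_simps inj_simps dest: arc_in_verts)
    (metis arc_in_verts inj_simps)+

lemmas parcs_doubling = centre_no_loop parcs_doubling_centre parcs_doubling_copies

lemma tournament_doubling: "tournament doubling"
proof
  show "finite (pverts doubling)"
    by (simp add: pverts_doubling)
  then have "finite (pverts doubling \<times> pverts doubling)"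
    by simp
  moreover have "parcs doubling \<subseteq> pverts doubling \<times> pverts doubling"
    by (auto simp: doubling_def dest: arc_in_verts)
  ultimately show "finite (parcs doubling)"
    by (rule rev_finite_subset)
  show "fst e \<in> pverts doubling" "snd e \<in> pverts doubling" if "e \<in> parcs doubling" for e
    using that \<open>parcs doubling \<subseteq> _\<close> by auto
  show "fst e \<noteq> snd e" if "e \<in> parcs doubling" for e
    using that no_loops
    by (auto simp: doubling_def neq_simps dest: arc_in_verts) (metis arc_in_verts inj_simps)+
  show "pverts doubling \<noteq> {}"
    by (simp add: pverts_doubling)
  show "(u, v) \<in> parcs doubling \<longleftrightarrow> (v, u) \<notin> parcs doubling"
    if "u \<in> pverts doubling" "v \<in> pverts doubling" "u \<noteq> v" for u v
    using that unfolding pverts_doubling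
    by - (elim insertE UnE imageE; simp add: parcs_doubling; metis arc_iff)
qed

lemma centre_neighbourhoods:
  "IN doubling c = b ` pverts T" "OUT doubling c = a ` pverts T"
  by (auto simp: IN_def OUT_def pverts_doubling parcs_doubling)

text \<open>The one further vertex is \<open>c\<close> on one side and the twin of the vertex in the
  other copy on the other side.\<close>

lemma copy_neighbourhoods:
  assumes "x \<in> pverts T"
  shows "OUT doubling (a x) = a ` OUT T x \<union> b ` insert x (IN T x)"
    "IN doubling (a x) = insert c (a ` IN T x \<union> b ` OUT T x)"
    "OUT doubling (b x) = insert c (a ` IN T x \<union> b ` OUT T x)"
    "IN doubling (b x) = a ` insert x (OUT T x) \<union> b ` IN T x"
  using assms by (auto simp: IN_def OUT_def pverts_doubling parcs_doubling)

lemma card_copies: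
  assumes "A \<subseteq> pverts T" "B \<subseteq> pverts T"
  shows "card (a ` A \<union> b ` B) = card A + card B"
    "card (insert c (a ` A \<union> b ` B)) = Suc (card A + card B)"
proof -
  have fin: "finite A" "finite B"
    using assms finite_subset[OF _ pair_finite_verts] by auto
  have "a ` A \<inter> b ` B = {}"
    using assms a_neq_b by blast
  then show *: "card (a ` A \<union> b ` B) = card A + card B"
    using fin assms inj_a inj_b
    by (simp add: card_Un_disjoint card_image inj_on_subset)
  have "c \<notin> a ` A \<union> b ` B"
    using assms a_neq_c b_neq_c by blast
  then show "card (insert c (a ` A \<union> b ` B)) = Suc (card A + card B)"
    using * fin by simp
qed

lemma regular_doubling: "regular_tournament doubling"
proof -
  have "card (IN doubling v) = card (OUT doubling v)" if v: "v \<in> pverts doubling" for v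
  proof -
    consider "v = c" | x where "x \<in> pverts T" "v = a x \<or> v = b x"
      using v by (auto simp: pverts_doubling)
    then show ?thesis
    proof cases
      case 1
      then show ?thesis
        by (simp add: centre_neighbourhoods card_image inj_a inj_b)
    next
      case 2
      have sub: "IN T x \<subseteq> pverts T" "OUT T x \<subseteq> pverts T"
        by (auto simp: IN_def OUT_def)
      \<comment> \<open>Hence inserting the twin adds exactly one to the degree and balances the
        contribution of \<open>c\<close>.\<close>
      have "x \<notin> IN T x" "x \<notin> OUT T x"
        by (auto simp: IN_def OUT_def dest: no_loops)
      then have "card (insert x (IN T x)) = Suc (card (IN T x))"
        "card (insert x (OUT T x)) = Suc (card (OUT T x))"
        using sub finite_subset[OF _ pair_finite_verts] by auto
      with 2 sub show ?thesis
        \<comment> \<open>With \<open>image_insert\<close> active, the inserted twin would leave the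
          image and \<open>card_copies\<close> would no longer match.\<close>
        by (auto simp: copy_neighbourhoods card_copies simp del: image_insert)
    qed
  qed
  then show ?thesis
    by (simp add: regular_tournament_def tournament_doubling)
qed

lemma type_I_doubling: "type_I_tournament doubling"
proof -
  \<comment> \<open>Around \<open>c\<close> the in-neighbours are the second copy and the
    out-neighbours the first. Both carry the arcs of \<open>T\<close> unreversed, so sending
    \<open>b x\<close> to \<open>a x\<close> is an isomorphism.\<close>
  let ?g = "a \<circ> the_inv_into (pverts T) b"
  have "bij_betw ?g (IN doubling c) (OUT doubling c)"
    unfolding centre_neighbourhoods
    using inj_a inj_b
    by (meson bij_betw_imageI bij_betw_the_inv_into bij_betw_trans)
  moreover have "?g (b x) = a x" if "x \<in> pverts T" for x
    using that by (simp add: the_inv_into_f_f inj_b)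
  ultimately have "digraph_iso (with_proj doubling \<restriction> IN doubling c)
    (with_proj doubling \<restriction> OUT doubling c)"
    unfolding digraph_iso_induced_iff
    \<comment> \<open>The composition stays folded so that the equation
      \<open>?g (b x) = a x\<close> can rewrite it.\<close>
    by (intro exI[of _ ?g]) (auto simp: centre_neighbourhoods parcs_doubling simp del: comp_apply)
  then show ?thesis
    using regular_doubling by (auto simp: type_I_tournament_def pverts_doubling)
qed

end

theorem lemma4p3:
  fixes T :: "'a pair_pre_digraph"
  assumes "tournament T"
  shows "\<exists>(R :: nat pair_pre_digraph) (f :: 'a \<Rightarrow> nat).
           type_I_tournament R \<and>
           inj_on f (pverts T) \<and> f ` pverts T \<subseteq> pverts R \<and>
           (\<forall>x \<in> pverts T. \<forall>y \<in> pverts T. (x, y) \<in> parcs T \<longleftrightarrow> (f x, f y) \<in> parcs R)"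
proof -
  interpret tournament T by fact
  obtain k :: "'a \<Rightarrow> nat" where k: "inj_on k (pverts T)"
    using finite_imp_inj_to_nat_seg[OF pair_finite_verts] by blast
  \<comment> \<open>Parity separates the two copies, and the positive offsets keep 0 free for the
    centre.\<close>
  define a b where "a x = 2 * k x + 1" and "b x = 2 * k x + 2" for x
  interpret tournament_doubling T a b 0
  proof
    show "a x \<noteq> b y" for x y
      unfolding a_def b_def by presburger
  qed (use k in \<open>auto simp: a_def b_def inj_on_def\<close>)
  show ?thesis
    using type_I_doubling inj_a
    by (intro exI[of _ doubling] exI[of _ a]) (auto simp: pverts_doubling parcs_doubling)
qed

end
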